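(* Let $n\ge 3$, $\alpha\in[2,n)$ and $\sigma\in(-\infty,\alpha)$. Then the integral equation $$u(x)=\int_{\mathbb{R}^n}\frac{u(y)^p}{|x-y|^{n-\alpha}|y|^{\sigma}}\,dy$$ has no positive radial solution if $$0<p<\frac{n+\alpha-2\sigma}{n-\alpha}.$$
   Context: A positive radial solution is understood to be a positive, radially symmetric, decreasing (in $|x|$) function in $C^{\lfloor\alpha\rfloor}(\mathbb{R}^n\setminus\{0\})\cap C(\mathbb{R}^n)$ satisfying the integral equation, where $\lfloor\cdot\rfloor$ is the greatest integer function. *)

theory Defs
  imports "HOL-Analysis.Analysis"
begin

text \<open>
  The class \<open>C\<^sup>k(S)\<close> of real-valued functions on an open set \<open>S\<close>: the \<open>i\<close>-th partial derivative at
  \<open>x\<close> is the Frechet derivative at \<open>x\<close> applied to the basis vector \<open>i\<close>. On open sets, total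
  differentiability in the successor case is implied by continuity of the partial derivatives, so
  this is the usual class of functions with continuous partial derivatives up to order \<open>k\<close>.
  The definition is only meant for open \<open>S\<close>.
\<close>

primrec C_k_on :: "nat \<Rightarrow> 'a::euclidean_space set \<Rightarrow> ('a \<Rightarrow> real) \<Rightarrow> bool" where
  "C_k_on 0 S f \<longleftrightarrow> continuous_on S f"
| "C_k_on (Suc k) S f \<longleftrightarrow> (\<forall>x\<in>S. f differentiable (at x)) \<and>
     (\<forall>i\<in>Basis. C_k_on k S (\<lambda>x. frechet_derivative f (at x) i))"

definition radially_symmetric :: "('a::real_normed_vector \<Rightarrow> real) \<Rightarrow> bool" where
  "radially_symmetric u \<longleftrightarrow> (\<forall>x y. norm x = norm y \<longrightarrow> u x = u y)"

text \<open>Decreasing is meant in the weak sense, so strictly decreasing functions are included.\<close>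

definition radially_decreasing :: "('a::real_normed_vector \<Rightarrow> real) \<Rightarrow> bool" where
  "radially_decreasing u \<longleftrightarrow> (\<forall>x y. norm x \<le> norm y \<longrightarrow> u y \<le> u x)"

text \<open>
  The integral equation is required at every point \<open>x\<close>, including the origin, and
  \<open>has_bochner_integral\<close> includes convergence of the (Lebesgue) integral. The values that
  division by zero gives to the integrand at \<open>y = x\<close> and \<open>y = 0\<close> only matter on a null set.
\<close>

definition solves_integral_equation ::
    "real \<Rightarrow> real \<Rightarrow> real \<Rightarrow> (real ^ 'n::finite \<Rightarrow> real) \<Rightarrow> bool" where
  "solves_integral_equation \<alpha> \<sigma> p u \<longleftrightarrow>
     (\<forall>x. has_bochner_integral lborel
        (\<lambda>y. u y powr p / (norm (x - y) powr (real CARD('n) - \<alpha>) * norm y powr \<sigma>)) (u x))"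

definition positive_radial_solution ::
    "real \<Rightarrow> real \<Rightarrow> real \<Rightarrow> (real ^ 'n::finite \<Rightarrow> real) \<Rightarrow> bool" where
  "positive_radial_solution \<alpha> \<sigma> p u \<longleftrightarrow>
     (\<forall>x. 0 < u x) \<and> radially_symmetric u \<and> radially_decreasing u \<and>
     C_k_on (nat \<lfloor>\<alpha>\<rfloor>) (- {0}) u \<and> continuous_on UNIV u \<and>
     solves_integral_equation \<alpha> \<sigma> p u"

end

theory Submission
  imports Defs
begin

text \<open>
  Let \<open>\<mu>\<close> be the measure \<open>|y|\<^sup>-\<^sup>\<sigma> dy\<close> on the space of dimension \<open>n\<close>, and write \<open>N = n - \<sigma>\<close>; the
  equation says that \<open>u\<close> is the Riesz potential of \<open>u\<^sup>p\<close> with respect to \<open>\<mu>\<close>. The proof is a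
  Pohozaev argument: it compares \<open>u\<close> with its dilates \<open>v(x) = u(c x)\<close> for \<open>c > 1\<close> close to 1, and
  the Pohozaev identity appears as a statement about difference quotients in \<open>c\<close>.

  The kernel and \<open>\<mu>\<close> are homogeneous, so \<open>c\<^sup>\<sigma>\<^sup>-\<^sup>\<alpha> v\<close> is the Riesz potential of \<open>v\<^sup>p\<close>. As the kernel is
  symmetric, \<open>\<integral> u\<^sup>p v d\<mu> = c\<^sup>\<alpha>\<^sup>-\<^sup>\<sigma> \<integral> v\<^sup>p u d\<mu>\<close> (lemma \<open>mixed_energy_reciprocity\<close>). Moreover the energy
  \<open>E = \<integral> u\<^bsup>p+1\<^esup> d\<mu>\<close> satisfies \<open>\<integral> v\<^bsup>p+1\<^esup> d\<mu> = c\<^bsup>-N\<^esup> E\<close>, and Young's inequality bounds the mixed energy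
  \<open>\<integral> u\<^sup>p v d\<mu>\<close> by the two energies. These three facts give a lower bound for
  \<open>D(c) = \<integral> (u\<^sup>p - v\<^sup>p) (u - v) d\<mu>\<close> whose expansion at \<open>c = 1\<close> starts with
  \<open>E (2 N - (p + 1) (n - \<alpha>)) / (p + 1) \<cdot> (c - 1)\<close> (lemma \<open>integral_defect_ge\<close>). The coefficient is positive
  exactly when \<open>p\<close> is subcritical.

  On the other hand \<open>D(c)\<close> is a product of two differences and hence of smaller order than \<open>c - 1\<close>
  (lemma \<open>eventually_defect_le\<close>). This is where the monotonicity of \<open>u\<close> enters: from \<open>v \<le> u\<close> the
  integrand is at most \<open>u\<^bsup>p+1\<^esup> - v\<^bsup>p+1\<^esup>\<close>, whose integral over the exterior of a ball is computed by scaling and is at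
  most \<open>c - 1\<close> times a constant that is small for large balls, while inside the ball uniform continuity
  gains an arbitrarily small factor. The two bounds contradict each other.

  Two preliminary facts make these integrals meaningful. Restricting the potential to the ball of
  radius \<open>|x|\<close>, on which \<open>u \<ge> u(x)\<close>, yields \<open>u(x) \<ge> const \<cdot> u(x)\<^sup>p |x|\<^bsup>\<alpha>-\<sigma>\<^esup>\<close>. This is impossible
  for large \<open>|x|\<close> if \<open>p \<le> 1\<close>, and for \<open>p > 1\<close> it is a decay estimate. In the subcritical range this decay
  makes \<open>u(x)\<^bsup>p+1\<^esup> |x|\<^sup>N\<close> vanish at infinity at a power rate, so that \<open>E\<close> is finite.
\<close>

section \<open>Lebesgue measure weighted by a power of the norm\<close>

definition power_measure :: "real \<Rightarrow> 'a::euclidean_space measure" where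
  "power_measure s = density lborel (\<lambda>y. ennreal (norm y powr - s))"

lemma sets_power_measure [simp, measurable_cong]: "sets (power_measure s) = sets borel"
  by (simp add: power_measure_def)

lemma space_power_measure [simp]: "space (power_measure s) = UNIV"
  by (simp add: power_measure_def)

lemma nn_integral_power_measure:
  assumes [measurable]: "f \<in> borel_measurable borel"
  shows "(\<integral>\<^sup>+y. f y \<partial>power_measure s) = (\<integral>\<^sup>+y. ennreal (norm y powr - s) * f y \<partial>lborel)"
  unfolding power_measure_def by (subst nn_integral_density) auto

lemma sigma_finite_power_measure: "sigma_finite_measure (power_measure s)"
  unfolding power_measure_def by (subst sigma_finite_measure.sigma_finite_iff_density_finite[OF sigma_finite_lborel]) auto

lemma nn_integral_power_measure_scaleR:
  fixes f :: "'a::euclidean_space \<Rightarrow> ennreal"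
  assumes [measurable]: "f \<in> borel_measurable borel" and c: "0 < c"
  shows "(\<integral>\<^sup>+y. f y \<partial>power_measure s)
    = ennreal (c powr (real DIM('a) - s)) * (\<integral>\<^sup>+y. f (c *\<^sub>R y) \<partial>power_measure s)"
proof -
  have "(\<integral>\<^sup>+y. f y \<partial>power_measure s)
      = (\<integral>\<^sup>+y. ennreal (norm y powr - s) * f y
          \<partial>density (distr lborel borel (\<lambda>x. 0 + c *\<^sub>R x)) (\<lambda>_. \<bar>c\<bar> ^ DIM('a)))"
    using lborel_affine[of c "0::'a"] c by (simp add: nn_integral_power_measure)
  also have "\<dots> = (\<integral>\<^sup>+y. ennreal (c ^ DIM('a)) * (ennreal (norm (c *\<^sub>R y) powr - s) * f (c *\<^sub>R y)) \<partial>lborel)"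
    using c by (subst nn_integral_density) (auto simp: nn_integral_distr)
  also have "\<dots> = (\<integral>\<^sup>+y. ennreal (c powr (real DIM('a) - s)) * (ennreal (norm y powr - s) * f (c *\<^sub>R y)) \<partial>lborel)"
  proof (rule nn_integral_cong)
    fix y :: 'a
    have "c ^ DIM('a) * norm (c *\<^sub>R y) powr - s = c powr (real DIM('a) - s) * norm y powr - s"
      using c by (simp add: powr_mult powr_diff powr_minus_divide powr_realpow)
    then show "ennreal (c ^ DIM('a)) * (ennreal (norm (c *\<^sub>R y) powr - s) * f (c *\<^sub>R y))
      = ennreal (c powr (real DIM('a) - s)) * (ennreal (norm y powr - s) * f (c *\<^sub>R y))"
      using c by (simp add: mult.assoc[symmetric] ennreal_mult[symmetric])
  qed
  also have "\<dots> = ennreal (c powr (real DIM('a) - s)) * (\<integral>\<^sup>+y. f (c *\<^sub>R y) \<partial>power_measure s)"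
    by (simp add: nn_integral_cmult nn_integral_power_measure)
  finally show ?thesis .
qed

lemma emeasure_power_measure_cball:
  assumes "0 < r"
  shows "emeasure (power_measure s) (cball (0::'a::euclidean_space) r)
    = ennreal (r powr (real DIM('a) - s)) * emeasure (power_measure s) (cball (0::'a) 1)"
proof -
  have "indicator (cball 0 r) (r *\<^sub>R y) = (indicator (cball 0 1) y :: ennreal)" for y :: 'a
    using assms by (simp add: indicator_def)
  with nn_integral_power_measure_scaleR[of "indicator (cball (0::'a) r)" r s] assms
  show ?thesis by (simp add: borel_measurable_indicator)
qed

text \<open>A ball and its complement both split into annuli that are dilates of one annulus, so that
  their measures are dominated by a geometric series; the ratio is less than one for dilations
  with \<open>c < 1\<close> when \<open>s < n\<close>, and for dilations with \<open>c > 1\<close> when \<open>s > n\<close>.\<close>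

lemma emeasure_dilated_annuli_finite:
  fixes s c :: real
  assumes c: "0 < c" and ratio: "c powr (real DIM('a::euclidean_space) - s) < 1"
  shows "emeasure (power_measure s) (\<Union>k::nat. {y::'a. norm y / c ^ k \<in> {1/2..2}}) < \<infinity>"
proof -
  define A where "A = {y::'a. norm y \<in> {1/2..2}}"
  define S where "S k = {y::'a. norm y / c ^ k \<in> {1/2..2}}" for k :: nat
  define q where "q = c powr (real DIM('a) - s)"
  have Am[measurable]: "A \<in> sets borel" and Sm[measurable]: "S k \<in> sets borel" for k
    unfolding A_def S_def by measurable
  have "emeasure (power_measure s) A = (\<integral>\<^sup>+y. ennreal (norm y powr - s) * indicator A y \<partial>lborel)"
    using nn_integral_power_measure[of "indicator A" s] by simp
  also have "\<dots> \<le> (\<integral>\<^sup>+y. ennreal (2 powr \<bar>s\<bar>) * indicator (cball (0::'a) 2) y \<partial>lborel)"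
  proof (rule nn_integral_mono)
    fix y :: 'a
    show "ennreal (norm y powr - s) * indicator A y \<le> ennreal (2 powr \<bar>s\<bar>) * indicator (cball 0 2) y"
    proof (cases "y \<in> A")
      case True
      then have y: "1/2 \<le> norm y" "norm y \<le> 2" by (auto simp: A_def)
      have "norm y powr - s \<le> 2 powr \<bar>s\<bar>"
      proof (cases "0 \<le> s")
        case True
        then have "norm y powr - s \<le> (1/2) powr - s"
          using y by (intro powr_mono2') auto
        also have "\<dots> = 2 powr \<bar>s\<bar>"
          using True by (simp add: powr_divide powr_minus_divide)
        finally show ?thesis .
      next
        case False
        then show ?thesis using y by (auto intro!: powr_mono2)
      qed
      then show ?thesis using True y by (simp add: ennreal_leI)
    qed simp
  qed
  also have "\<dots> = ennreal (2 powr \<bar>s\<bar>) * emeasure lborel (cball (0::'a) 2)"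
    by (subst nn_integral_cmult_indicator) auto
  also have "\<dots> < \<infinity>"
    using emeasure_lborel_cball_finite[of "0::'a" 2] by (simp add: ennreal_mult_less_top)
  finally have A: "emeasure (power_measure s) A < \<infinity>" .
  have S: "emeasure (power_measure s) (S k) = ennreal (q ^ k) * emeasure (power_measure s) A" for k
  proof -
    have "indicator (S k) (c ^ k *\<^sub>R y) = (indicator A y :: ennreal)" for y
      using c by (simp add: indicator_def S_def A_def)
    moreover have "(c ^ k) powr (real DIM('a) - s) = q ^ k"
      using c by (simp add: q_def powr_realpow[symmetric] powr_powr mult.commute)
    ultimately show ?thesis
      using nn_integral_power_measure_scaleR[of "indicator (S k)" "c ^ k" s] c by simp
  qed
  have "emeasure (power_measure s) (\<Union>k. S k) \<le> (\<Sum>k. emeasure (power_measure s) (S k))"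
    by (intro emeasure_subadditive_countably) auto
  also have "\<dots> = (\<Sum>k. ennreal (q ^ k)) * emeasure (power_measure s) A"
    unfolding S by (rule ennreal_suminf_multc)
  also have "\<dots> < \<infinity>"
  proof -
    have "summable (\<lambda>k. q ^ k)" using ratio c by (simp add: q_def summable_geometric)
    then have "(\<Sum>k. ennreal (q ^ k)) < \<infinity>"
      by (simp add: q_def suminf_ennreal2)
    then show ?thesis using A by (simp add: ennreal_mult_less_top)
  qed
  finally show ?thesis unfolding S_def .
qed

lemma power_of_two_below:
  fixes t :: real
  assumes "1 \<le> t"
  obtains k :: nat where "2 ^ k \<le> t" "t \<le> 2 ^ Suc k"
proof -
  define k where "k = nat \<lfloor>log 2 t\<rfloor>"
  have l: "0 \<le> log 2 t" using assms by simp
  then have k: "real k \<le> log 2 t" "log 2 t \<le> real (Suc k)"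
    unfolding k_def by linarith+
  have "2 ^ k \<le> t" 
    using k(1) assms by (simp add: le_log_iff powr_realpow)
  moreover have "t \<le> 2 ^ Suc k"
    using k(2) assms log_le_iff[of 2 t "real (Suc k)"] powr_realpow[of 2 "Suc k"] by simp
  ultimately show ?thesis by (rule that)
qed

lemma emeasure_power_measure_cball_finite:
  assumes "s < real DIM('a::euclidean_space)"
  shows "emeasure (power_measure s) (cball (0::'a) 1) < \<infinity>"
proof -
  let ?U = "\<Union>k::nat. {y::'a. norm y / (1/2) ^ k \<in> {1/2..2}}"
  have "(1/2) powr (real DIM('a) - s) < 1 powr (real DIM('a) - s)"
    using assms by (intro powr_less_mono2) auto
  then have fin: "emeasure (power_measure s) ?U < \<infinity>"
    by (intro emeasure_dilated_annuli_finite) auto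
  have "cball (0::'a) 1 \<subseteq> insert 0 ?U"
  proof
    fix x :: 'a assume x: "x \<in> cball 0 1"
    show "x \<in> insert 0 ?U"
    proof (cases "x = 0")
      case False
      then obtain k where "2 ^ k \<le> 1 / norm x" "1 / norm x \<le> 2 ^ Suc k"
        using power_of_two_below[of "1 / norm x"] x by auto
      then have "norm x / (1/2) ^ k \<in> {1/2..2}"
        using False by (auto simp: field_simps)
      then show ?thesis by blast
    qed simp
  qed
  then have "emeasure (power_measure s) (cball (0::'a) 1) \<le> emeasure (power_measure s) (insert 0 ?U)"
    by (intro emeasure_mono) auto
  also have "\<dots> \<le> emeasure (power_measure s) {0::'a} + emeasure (power_measure s) ?U"
    using emeasure_subadditive[of "{0::'a}" "power_measure s" ?U] by simp
  also have "emeasure (power_measure s) {0::'a} = (\<integral>\<^sup>+y. ennreal (norm y powr - s) * indicator {0::'a} y \<partial>lborel)"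
    using nn_integral_power_measure[of "indicator {0::'a}" s] by simp
  also have "\<dots> = 0"
    by (simp add: nn_integral_0_iff_AE)
  finally show ?thesis using fin by (simp add: le_less_trans)
qed

lemma emeasure_power_measure_outside_cball_finite:
  assumes "real DIM('a::euclidean_space) < s"
  shows "emeasure (power_measure s) (- cball (0::'a) 1) < \<infinity>"
proof -
  let ?U = "\<Union>k::nat. {y::'a. norm y / 2 ^ k \<in> {1/2..2}}"
  have "2 powr (real DIM('a) - s) < 2 powr 0"
    using assms by (intro powr_less_mono) auto
  then have fin: "emeasure (power_measure s) ?U < \<infinity>"
    by (intro emeasure_dilated_annuli_finite) auto
  have "- cball (0::'a) 1 \<subseteq> ?U"
  proof
    fix x :: 'a assume x: "x \<in> - cball 0 1"
    then obtain k where k: "2 ^ k \<le> norm x" "norm x \<le> 2 ^ Suc k"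
      using power_of_two_below[of "norm x"] by auto
    have "(1/2) * 2 ^ k \<le> (2::real) ^ k" by simp
    then have "norm x / 2 ^ k \<in> {1/2..2}"
      using k by (auto simp: field_simps simp del: mult_le_cancel_right1)
    then show "x \<in> ?U" by blast
  qed
  then have "emeasure (power_measure s) (- cball (0::'a) 1) \<le> emeasure (power_measure s) ?U"
    by (intro emeasure_mono) auto
  with fin show ?thesis by simp
qed

text \<open>The density vanishes only at the origin, where \<open>0 powr - s = 0\<close>.\<close>

lemma emeasure_power_measure_cball_pos: "0 < emeasure (power_measure s) (cball (0::'a::euclidean_space) 1)"
proof -
  have "\<not> (AE y in lborel. ennreal (norm y powr - s) * indicator (cball (0::'a) 1) y = 0)"
  proof
    assume "AE y in lborel. ennreal (norm y powr - s) * indicator (cball (0::'a) 1) y = 0"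
    moreover have "AE y in lborel. y \<noteq> (0::'a)" by (rule AE_lborel_singleton)
    ultimately have "AE y in lborel. y \<notin> cball (0::'a) 1"
      by eventually_elim (auto simp: indicator_def split: if_splits)
    then have "emeasure lborel (cball (0::'a) 1) = 0"
      by (subst (asm) AE_iff_measurable[of "cball 0 1"]) auto
    moreover have "0 < emeasure lborel (cball (0::'a) 1)"
      using unit_ball_vol_pos[of "DIM('a)"] by (simp add: emeasure_cball)
    ultimately show False by simp
  qed
  then have "(\<integral>\<^sup>+y. ennreal (norm y powr - s) * indicator (cball (0::'a) 1) y \<partial>lborel) \<noteq> 0"
    by (subst nn_integral_0_iff_AE) (measurable, simp)
  then show ?thesis
    using nn_integral_power_measure[of "indicator (cball (0::'a) 1)" s]
    by (simp add: zero_less_iff_neq_zero borel_measurable_indicator)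
qed

text \<open>The value \<open>0 powr (\<alpha> - n) = 0\<close> of the Riesz kernel on the diagonal is an artefact that lower bounds
  for the kernel have to avoid; the diagonal is negligible by this lemma.\<close>

lemma AE_power_measure_neq: "AE y in power_measure s. y \<noteq> (x::'a::euclidean_space)"
  unfolding power_measure_def
  by (subst AE_density) (auto intro: eventually_mono[OF AE_lborel_singleton])

lemma nn_integral_symmetric_kernel:
  fixes k :: "'a \<Rightarrow> 'a \<Rightarrow> ennreal"
  assumes "sigma_finite_measure M"
    and [measurable]: "f \<in> borel_measurable M" "g \<in> borel_measurable M"
      "(\<lambda>(x, y). k x y) \<in> borel_measurable (M \<Otimes>\<^sub>M M)"
    and sym: "\<And>x y. k x y = k y x"
  shows "(\<integral>\<^sup>+x. f x * (\<integral>\<^sup>+y. g y * k x y \<partial>M) \<partial>M) = (\<integral>\<^sup>+x. g x * (\<integral>\<^sup>+y. f y * k x y \<partial>M) \<partial>M)"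
proof -
  interpret sigma_finite_measure M by fact
  interpret pair_sigma_finite M M ..
  have k [measurable]: "k x \<in> borel_measurable M" if "x \<in> space M" for x
    using measurable_Pair2[OF assms(4) that] by simp
  have "(\<integral>\<^sup>+x. f x * (\<integral>\<^sup>+y. g y * k x y \<partial>M) \<partial>M) = (\<integral>\<^sup>+x. \<integral>\<^sup>+y. f x * (g y * k x y) \<partial>M \<partial>M)"
    by (intro nn_integral_cong nn_integral_cmult[symmetric]) (use k in measurable)
  also have "\<dots> = (\<integral>\<^sup>+y. \<integral>\<^sup>+x. f x * (g y * k x y) \<partial>M \<partial>M)"
    by (rule Fubini'[symmetric]) measurable
  also have "\<dots> = (\<integral>\<^sup>+y. \<integral>\<^sup>+x. g y * (f x * k y x) \<partial>M \<partial>M)"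
    by (simp add: ac_simps sym)
  also have "\<dots> = (\<integral>\<^sup>+y. g y * (\<integral>\<^sup>+x. f x * k y x \<partial>M) \<partial>M)"
    by (intro nn_integral_cong nn_integral_cmult) (use k in measurable)
  finally show ?thesis .
qed

section \<open>Decay of decreasing solutions\<close>

text \<open>The equation is stated with the nonnegative integral and with the factor \<open>|y|\<^sup>-\<^sup>\<sigma>\<close> moved into the measure:
  then dilations and exchanges of the order of integration come without integrability
  conditions.\<close>

locale radial_solution =
  fixes u :: "'a::euclidean_space \<Rightarrow> real" and \<alpha> \<sigma> p :: real
  assumes pos: "\<And>x. 0 < u x"
    and decreasing: "\<And>x y. norm x \<le> norm y \<Longrightarrow> u y \<le> u x"
    and continuous: "continuous_on UNIV u"
    and \<alpha>_less: "\<alpha> < real DIM('a)" and \<sigma>_less: "\<sigma> < \<alpha>" and p_pos: "0 < p"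
    and equation: "\<And>x. (\<integral>\<^sup>+y. ennreal (u y powr p) * ennreal (norm (x - y) powr (\<alpha> - real DIM('a)))
      \<partial>power_measure \<sigma>) = ennreal (u x)"
begin

abbreviation \<mu> :: "'a measure" where "\<mu> \<equiv> power_measure \<sigma>"

text \<open>The homogeneity degree of \<open>\<mu>\<close>: balls of radius \<open>r\<close> about the origin have mass proportional to \<open>r\<^sup>N\<close>.\<close>

definition N :: real where "N = real DIM('a) - \<sigma>"

definition unit_mass :: real where "unit_mass = measure \<mu> (cball 0 1)"

lemma N_pos: "0 < N"
  using \<alpha>_less \<sigma>_less by (simp add: N_def)

lemma measurable_u [measurable]: "u \<in> borel_measurable borel"
  using continuous by (rule borel_measurable_continuous_onI)

lemma unit_mass: "emeasure \<mu> (cball 0 1) = ennreal unit_mass" and unit_mass_pos: "0 < unit_mass"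
proof -
  have fin: "emeasure \<mu> (cball 0 1) < \<infinity>"
    using N_pos by (intro emeasure_power_measure_cball_finite) (simp add: N_def)
  then show eq: "emeasure \<mu> (cball 0 1) = ennreal unit_mass"
    unfolding unit_mass_def by (intro emeasure_eq_ennreal_measure) auto
  show "0 < unit_mass"
    using emeasure_power_measure_cball_pos[of \<sigma>, where 'a='a] unfolding eq by simp
qed

lemma emeasure_cball: "0 < r \<Longrightarrow> emeasure \<mu> (cball 0 r) = ennreal (r powr N * unit_mass)"
  using emeasure_power_measure_cball[of r \<sigma>, where 'a='a] unit_mass_pos
  by (simp add: unit_mass ennreal_mult N_def)

text \<open>On the ball of radius \<open>|x|\<close> both \<open>u\<close> is at least \<open>u x\<close> and \<open>|x - y| \<le> 2 |x|\<close>; this part of the potential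
  alone gives the bound.\<close>

lemma solution_lower_bound:
  assumes "x \<noteq> 0"
  shows "u x powr p * (2 * norm x) powr (\<alpha> - real DIM('a)) * (norm x powr N * unit_mass) \<le> u x"
proof -
  let ?c = "u x powr p * (2 * norm x) powr (\<alpha> - real DIM('a))"
  have "ennreal (?c * (norm x powr N * unit_mass)) = (\<integral>\<^sup>+y. ennreal ?c * indicator (cball 0 (norm x)) y \<partial>\<mu>)"
    using assms unit_mass_pos
    by (subst nn_integral_cmult_indicator) (auto simp: emeasure_cball ennreal_mult)
  also have "\<dots> \<le> (\<integral>\<^sup>+y. ennreal (u y powr p) * ennreal (norm (x - y) powr (\<alpha> - real DIM('a))) \<partial>\<mu>)"
  proof (rule nn_integral_mono_AE)
    show "AE y in \<mu>. ennreal ?c * indicator (cball 0 (norm x)) y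
        \<le> ennreal (u y powr p) * ennreal (norm (x - y) powr (\<alpha> - real DIM('a)))"
      using AE_power_measure_neq[of x \<sigma>]
    proof eventually_elim
      case (elim y)
      show ?case
      proof (cases "norm y \<le> norm x")
        case True
        have "norm (x - y) \<le> 2 * norm x"
          using norm_triangle_ineq4[of x y] True by simp
        then have "(2 * norm x) powr (\<alpha> - real DIM('a)) \<le> norm (x - y) powr (\<alpha> - real DIM('a))"
          using elim \<alpha>_less by (intro powr_mono2') auto
        moreover have "u x powr p \<le> u y powr p"
          using decreasing[OF True] pos[of x] p_pos by (intro powr_mono2) auto
        ultimately show ?thesis
          using True by (simp add: ennreal_mult[symmetric] ennreal_leI mult_mono)
      qed simp
    qed
  qed
  also have "\<dots> = ennreal (u x)" by (rule equation)
  finally show ?thesis using pos[of x] by (simp add: ennreal_le_iff)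
qed

lemma solution_power_bound:
  assumes "x \<noteq> 0"
  shows "u x powr (p - 1) * norm x powr (\<alpha> - \<sigma>) \<le> 2 powr (real DIM('a) - \<alpha>) / unit_mass"
proof -
  define b where "b = real DIM('a) - \<alpha>"
  have "u x powr p * (2 * norm x) powr - b * (norm x powr N * unit_mass)
      = u x * (u x powr (p - 1) * norm x powr (\<alpha> - \<sigma>)) * (unit_mass / 2 powr b)"
    using assms pos[of x]
    by (simp add: powr_mult powr_minus_divide powr_diff b_def N_def field_simps)
  with solution_lower_bound[OF assms]
  have "u x * (u x powr (p - 1) * norm x powr (\<alpha> - \<sigma>) * (unit_mass / 2 powr b)) \<le> u x * 1"
    by (simp add: b_def mult.assoc)
  then have "u x powr (p - 1) * norm x powr (\<alpha> - \<sigma>) * (unit_mass / 2 powr b) \<le> 1"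
    using pos[of x] by (simp only: mult_le_cancel_left_pos)
  then show ?thesis
    using unit_mass_pos by (simp add: b_def field_simps)
qed

text \<open>If \<open>p \<le> 1\<close>, then \<open>u x powr (p - 1)\<close> stays above its value at the origin, whereas the power bound
  forces it to tend to zero at infinity.\<close>

lemma superlinear: "1 < p"
proof (rule ccontr)
  assume "\<not> 1 < p"
  define C where "C = 2 powr (real DIM('a) - \<alpha>) / unit_mass"
  \<comment> \<open>the radius at which the lower bound for the left-hand side of the power bound reaches \<open>C + 1\<close>\<close>
  define t where "t = ((C + 1) / u 0 powr (p - 1)) powr (1 / (\<alpha> - \<sigma>))"
  obtain e :: 'a where e: "norm e = 1"
    using nonempty_Basis norm_Basis by blast
  have C: "0 < C" using unit_mass_pos by (simp add: C_def)
  then have t: "0 < t" using pos[of 0] by (simp add: t_def)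
  have "C + 1 = u 0 powr (p - 1) * t powr (\<alpha> - \<sigma>)"
    using C pos[of 0] \<sigma>_less by (simp add: t_def powr_powr)
  also have "\<dots> \<le> u (t *\<^sub>R e) powr (p - 1) * norm (t *\<^sub>R e) powr (\<alpha> - \<sigma>)"
    using powr_mono2'[of "p - 1" "u (t *\<^sub>R e)" "u 0"] \<open>\<not> 1 < p\<close> pos decreasing[of 0 "t *\<^sub>R e"] t e \<sigma>_less
    by (intro mult_mono) auto
  also have "\<dots> \<le> C"
    unfolding C_def using t e by (intro solution_power_bound) auto
  finally show False by simp
qed

end

text \<open>The inequality \<open>p < (n + \<alpha> - 2 \<sigma>) / (n - \<alpha>)\<close>, in the form in which the argument meets it.\<close>

locale subcritical_radial_solution = radial_solution u \<alpha> \<sigma> p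
  for u :: "'a::euclidean_space \<Rightarrow> real" and \<alpha> \<sigma> p :: real +
  assumes subcritical: "(p + 1) * (real DIM('a) - \<alpha>) < 2 * (real DIM('a) - \<sigma>)"
begin

text \<open>Raising the power bound to the exponent \<open>(p + 1) / (p - 1)\<close> gives the decay rate \<open>(\<alpha> - \<sigma>) (p + 1) / (p - 1)\<close>
  of \<open>u\<^bsup>p+1\<^esup>\<close>. It exceeds \<open>N\<close> precisely because \<open>p\<close> is subcritical.\<close>

lemma decay:
  obtains C \<kappa> where "0 < C" "0 < \<kappa>" "\<And>x. x \<noteq> 0 \<Longrightarrow> u x powr (p + 1) \<le> C * norm x powr - (N + \<kappa>)"
proof -
  define m where "m = (p + 1) / (p - 1)"
  define \<kappa> where "\<kappa> = m * (\<alpha> - \<sigma>) - N"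
  define K where "K = 2 powr (real DIM('a) - \<alpha>) / unit_mass"
  have p: "1 < p" by (rule superlinear)
  then have m: "0 < m" by (simp add: m_def)
  have "0 < (p + 1) * (\<alpha> - \<sigma>) - N * (p - 1)"
    using subcritical by (simp add: N_def algebra_simps)
  then have "0 < ((p + 1) * (\<alpha> - \<sigma>) - N * (p - 1)) / (p - 1)"
    using p by (intro divide_pos_pos) auto
  also have "\<dots> = \<kappa>"
    using p by (simp add: \<kappa>_def m_def diff_divide_distrib)
  finally have \<kappa>: "0 < \<kappa>" .
  have K: "0 < K" using unit_mass_pos by (simp add: K_def)
  have "u x powr (p + 1) \<le> K powr m * norm x powr - (N + \<kappa>)" if x: "x \<noteq> 0" for x
  proof -
    have "u x powr (p - 1) \<le> K / norm x powr (\<alpha> - \<sigma>)"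
      using solution_power_bound[OF x] x by (subst pos_le_divide_eq) (simp_all add: K_def)
    also have "\<dots> = K * norm x powr - (\<alpha> - \<sigma>)"
      by (simp only: powr_minus_divide) simp
    finally have "(u x powr (p - 1)) powr m \<le> (K * norm x powr - (\<alpha> - \<sigma>)) powr m"
      using m by (intro powr_mono2) auto
    also have "(u x powr (p - 1)) powr m = u x powr (p + 1)"
      using p by (simp add: powr_powr m_def)
    also have "(K * norm x powr - (\<alpha> - \<sigma>)) powr m = K powr m * norm x powr - (N + \<kappa>)"
      using K by (simp add: powr_mult powr_powr \<kappa>_def algebra_simps)
    finally show ?thesis .
  qed
  with \<kappa> K show ?thesis by (intro that[of "K powr m" \<kappa>]) auto
qed

section \<open>Finiteness of the energy\<close>

lemma integrable_energy: "integrable \<mu> (\<lambda>x. u x powr (p + 1))"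
proof -
  obtain C \<kappa> where C: "0 < C" "0 < \<kappa>"
    and dec: "\<And>x. x \<noteq> 0 \<Longrightarrow> u x powr (p + 1) \<le> C * norm x powr - (N + \<kappa>)"
    using decay by blast
  define A where "A = u 0 powr (p + 1)"
  let ?in = "cball (0::'a) 1" and ?out = "- cball (0::'a) 1"
  have [measurable]: "?in \<in> sets borel" "?out \<in> sets borel" by auto
  have "(\<integral>\<^sup>+x. ennreal (u x powr (p + 1)) \<partial>\<mu>)
      \<le> (\<integral>\<^sup>+x. ennreal A * indicator ?in x
            + ennreal C * (ennreal (norm x powr - (N + \<kappa>)) * indicator ?out x) \<partial>\<mu>)"
  proof (rule nn_integral_mono)
    fix x
    show "ennreal (u x powr (p + 1)) \<le> ennreal A * indicator ?in x
            + ennreal C * (ennreal (norm x powr - (N + \<kappa>)) * indicator ?out x)"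
    proof (cases "norm x \<le> 1")
      case True
      have "u x powr (p + 1) \<le> A"
        unfolding A_def using decreasing[of 0 x] pos[of x] p_pos by (intro powr_mono2) auto
      then show ?thesis using True by (simp add: ennreal_leI)
    next
      case False
      then have "x \<noteq> 0" by auto
      then show ?thesis using dec[of x] False C by (simp add: ennreal_mult[symmetric] ennreal_leI)
    qed
  qed
  also have "\<dots> = ennreal A * emeasure \<mu> ?in
      + ennreal C * (\<integral>\<^sup>+x. ennreal (norm x powr - (N + \<kappa>)) * indicator ?out x \<partial>\<mu>)"
  proof -
    have "(\<integral>\<^sup>+x. ennreal A * indicator ?in x \<partial>\<mu>)
        = ennreal A * emeasure \<mu> ?in"
      by (rule nn_integral_cmult_indicator) simp
    moreover have "(\<integral>\<^sup>+x. ennreal C * (ennreal (norm x powr - (N + \<kappa>)) * indicator ?out x) \<partial>\<mu>)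
        = ennreal C * (\<integral>\<^sup>+x. ennreal (norm x powr - (N + \<kappa>)) * indicator ?out x \<partial>\<mu>)"
      by (rule nn_integral_cmult) measurable
    moreover have "(\<lambda>x. ennreal A * indicator ?in x) \<in> borel_measurable \<mu>"
      and "(\<lambda>x. ennreal C * (ennreal (norm x powr - (N + \<kappa>)) * indicator ?out x)) \<in> borel_measurable \<mu>"
      by measurable
    ultimately show ?thesis
      by (simp only: nn_integral_add)
  qed
  also have "(\<integral>\<^sup>+x. ennreal (norm x powr - (N + \<kappa>)) * indicator ?out x \<partial>\<mu>)
      = (\<integral>\<^sup>+x. ennreal (norm x powr - (real DIM('a) + \<kappa>)) * indicator ?out x \<partial>lborel)"
  proof -
    have "norm x powr - \<sigma> * norm x powr - (N + \<kappa>) = norm x powr - (real DIM('a) + \<kappa>)" for x :: 'a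
      by (simp only: powr_add[symmetric]) (simp add: N_def)
    then have "ennreal (norm x powr - \<sigma>) * (ennreal (norm x powr - (N + \<kappa>)) * indicator ?out x)
        = ennreal (norm x powr - (real DIM('a) + \<kappa>)) * indicator ?out x" for x :: 'a
      by (simp only: mult.assoc[symmetric] ennreal_mult[symmetric] powr_ge_zero)
    moreover have "(\<lambda>x. ennreal (norm x powr - (N + \<kappa>)) * indicator ?out x) \<in> borel_measurable borel"
      by measurable
    ultimately show ?thesis
      by (simp only: nn_integral_power_measure)
  qed
  also have "\<dots> = emeasure (power_measure (real DIM('a) + \<kappa>)) ?out"
    using nn_integral_power_measure[of "indicator ?out" "real DIM('a) + \<kappa>"]
    by (simp add: borel_measurable_indicator)
  also have "ennreal A * emeasure \<mu> ?in + ennreal C * \<dots> < \<infinity>"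
    using emeasure_power_measure_outside_cball_finite[of "real DIM('a) + \<kappa>", where 'a='a] C
    by (simp add: unit_mass ennreal_mult_less_top)
  finally show ?thesis
    by (intro integrableI_nonneg) auto
qed

definition energy :: real where "energy = (\<integral>x. u x powr (p + 1) \<partial>\<mu>)"

lemma energy_pos: "0 < energy"
proof -
  have "energy \<noteq> 0"
  proof
    assume "energy = 0"
    then have "AE x in \<mu>. u x powr (p + 1) = 0"
      using integral_nonneg_eq_0_iff_AE[OF integrable_energy] by (simp add: energy_def)
    then have "AE x in \<mu>. x \<notin> cball 0 1"
    proof eventually_elim
      case (elim x)
      then show ?case using pos[of x] by simp
    qed
    then have "emeasure \<mu> (cball 0 1) = 0"
      by (subst (asm) AE_iff_measurable[of "cball 0 1"]) auto
    then show False using unit_mass_pos by (simp add: unit_mass)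
  qed
  moreover have "0 \<le> energy" by (simp add: energy_def)
  ultimately show ?thesis by simp
qed

section \<open>Dilates of the solution\<close>

lemma has_bochner_integral_scaleR:
  assumes f: "integrable \<mu> f" "\<And>x. 0 \<le> f x" and c: "0 < c"
  shows "has_bochner_integral \<mu> (\<lambda>x. f (c *\<^sub>R x)) (c powr - N * (\<integral>x. f x \<partial>\<mu>))"
proof (rule has_bochner_integral_nn_integral)
  have [measurable]: "f \<in> borel_measurable borel"
    using f(1) by (simp add: borel_measurable_integrable measurable_cong_sets[of \<mu> borel borel borel])
  show "(\<lambda>x. f (c *\<^sub>R x)) \<in> borel_measurable \<mu>" by measurable
  have "ennreal (c powr N) * (\<integral>\<^sup>+x. f (c *\<^sub>R x) \<partial>\<mu>) = (\<integral>\<^sup>+x. f x \<partial>\<mu>)"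
    using nn_integral_power_measure_scaleR[of "\<lambda>x. ennreal (f x)" c \<sigma>] c by (simp add: N_def)
  also have "\<dots> = ennreal (\<integral>x. f x \<partial>\<mu>)"
    using f by (intro nn_integral_eq_integral) auto
  finally have eq: "ennreal (c powr N) * (\<integral>\<^sup>+x. f (c *\<^sub>R x) \<partial>\<mu>) = ennreal (\<integral>x. f x \<partial>\<mu>)" .
  have "(\<integral>\<^sup>+x. f (c *\<^sub>R x) \<partial>\<mu>) = ennreal (c powr - N) * (ennreal (c powr N) * (\<integral>\<^sup>+x. f (c *\<^sub>R x) \<partial>\<mu>))"
    using c by (simp add: mult.assoc[symmetric] ennreal_mult[symmetric] powr_add[symmetric])
  then show "(\<integral>\<^sup>+x. ennreal (f (c *\<^sub>R x)) \<partial>\<mu>) = ennreal (c powr - N * (\<integral>x. f x \<partial>\<mu>))"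
    unfolding eq by (simp add: ennreal_mult')
qed (use f in auto)

text \<open>Up to a constant, a dilate of \<open>u\<close> again solves the equation. The exponent is the sum of the
  degree \<open>n - \<sigma>\<close> of the measure and the degree \<open>\<alpha> - n\<close> of the kernel.\<close>

lemma equation_scaleR:
  assumes c: "0 < c"
  shows "ennreal (u (c *\<^sub>R x)) = ennreal (c powr (\<alpha> - \<sigma>)) *
    (\<integral>\<^sup>+y. ennreal (u (c *\<^sub>R y) powr p) * ennreal (norm (x - y) powr (\<alpha> - real DIM('a))) \<partial>\<mu>)"
proof -
  have "ennreal (u (c *\<^sub>R x))
      = ennreal (c powr (real DIM('a) - \<sigma>)) * (\<integral>\<^sup>+y. ennreal (u (c *\<^sub>R y) powr p)
          * ennreal (norm (c *\<^sub>R x - c *\<^sub>R y) powr (\<alpha> - real DIM('a))) \<partial>\<mu>)"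
    using c by (subst equation[symmetric], subst nn_integral_power_measure_scaleR[where c=c]) auto
  also have "\<dots> = ennreal (c powr (real DIM('a) - \<sigma>)) * (\<integral>\<^sup>+y. ennreal (c powr (\<alpha> - real DIM('a))) *
      (ennreal (u (c *\<^sub>R y) powr p) * ennreal (norm (x - y) powr (\<alpha> - real DIM('a)))) \<partial>\<mu>)"
  proof -
    have "norm (c *\<^sub>R x - c *\<^sub>R y) powr (\<alpha> - real DIM('a))
        = c powr (\<alpha> - real DIM('a)) * norm (x - y) powr (\<alpha> - real DIM('a))" for y
      using c by (simp add: real_vector.scale_right_diff_distrib[symmetric] powr_mult del: real_vector.scale_right_diff_distrib)
    then show ?thesis by (simp add: ennreal_mult mult.left_commute)
  qed
  also have "\<dots> = ennreal (c powr (real DIM('a) - \<sigma>) * c powr (\<alpha> - real DIM('a))) *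
      (\<integral>\<^sup>+y. ennreal (u (c *\<^sub>R y) powr p) * ennreal (norm (x - y) powr (\<alpha> - real DIM('a))) \<partial>\<mu>)"
    by (subst nn_integral_cmult) (auto simp: ennreal_mult mult.assoc)
  also have "c powr (real DIM('a) - \<sigma>) * c powr (\<alpha> - real DIM('a)) = c powr (\<alpha> - \<sigma>)"
    by (simp add: powr_add[symmetric])
  finally show ?thesis .
qed

lemma scaleR_le: "1 \<le> c \<Longrightarrow> u (c *\<^sub>R x) \<le> u x"
  by (intro decreasing) (simp add: mult_le_cancel_right1)

lemma powr_scaleR_le: "1 \<le> c \<Longrightarrow> 0 \<le> q \<Longrightarrow> u (c *\<^sub>R x) powr q \<le> u x powr q"
  using scaleR_le[of c x] pos[of "c *\<^sub>R x"] by (intro powr_mono2) auto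

lemma integrable_mixed:
  assumes "1 \<le> c"
  shows "integrable \<mu> (\<lambda>x. u x powr p * u (c *\<^sub>R x))" "integrable \<mu> (\<lambda>x. u (c *\<^sub>R x) powr p * u x)"
proof -
  have eq: "u x powr (p + 1) = u x powr p * u x" for x
    using pos[of x] by (simp add: powr_add)
  have u: "0 \<le> u x" for x using pos[of x] by simp
  have "u x powr p * u (c *\<^sub>R x) \<le> u x powr (p + 1)" for x
    unfolding eq using scaleR_le[OF assms] by (intro mult_left_mono) auto
  then show "integrable \<mu> (\<lambda>x. u x powr p * u (c *\<^sub>R x))"
    by (intro Bochner_Integration.integrable_bound[OF integrable_energy] AE_I2) (simp_all add: u)
  have "u (c *\<^sub>R x) powr p * u x \<le> u x powr (p + 1)" for x
    unfolding eq using powr_scaleR_le[OF assms] p_pos u by (intro mult_right_mono) auto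
  then show "integrable \<mu> (\<lambda>x. u (c *\<^sub>R x) powr p * u x)"
    by (intro Bochner_Integration.integrable_bound[OF integrable_energy] AE_I2) (simp_all add: u)
qed

text \<open>Both sides are the double integral of \<open>u(x)\<^sup>p u(c y)\<^sup>p\<close> against the kernel; the symmetry of the kernel
  decides which of the two factors is turned into a potential. Through this identity the equation enters
  the comparison of \<open>u\<close> with its dilates.\<close>

lemma mixed_energy_reciprocity:
  assumes "1 \<le> c"
  shows "(\<integral>x. u x powr p * u (c *\<^sub>R x) \<partial>\<mu>) = c powr (\<alpha> - \<sigma>) * (\<integral>x. u (c *\<^sub>R x) powr p * u x \<partial>\<mu>)"
proof -
  let ?k = "\<lambda>x y::'a. ennreal (norm (x - y) powr (\<alpha> - real DIM('a)))"
  have nonneg: "0 \<le> u x" for x using pos[of x] by simp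
  have "ennreal (\<integral>x. u x powr p * u (c *\<^sub>R x) \<partial>\<mu>) = (\<integral>\<^sup>+x. ennreal (u x powr p * u (c *\<^sub>R x)) \<partial>\<mu>)"
    using integrable_mixed(1)[OF assms] nonneg by (intro nn_integral_eq_integral[symmetric]) auto
  also have "\<dots> = (\<integral>\<^sup>+x. ennreal (c powr (\<alpha> - \<sigma>)) *
      (ennreal (u x powr p) * (\<integral>\<^sup>+y. ennreal (u (c *\<^sub>R y) powr p) * ?k x y \<partial>\<mu>)) \<partial>\<mu>)"
    using assms nonneg by (simp add: ennreal_mult equation_scaleR mult.left_commute)
  also have "\<dots> = ennreal (c powr (\<alpha> - \<sigma>)) *
      (\<integral>\<^sup>+x. ennreal (u x powr p) * (\<integral>\<^sup>+y. ennreal (u (c *\<^sub>R y) powr p) * ?k x y \<partial>\<mu>) \<partial>\<mu>)"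
  proof (rule nn_integral_cmult)
    interpret sigma_finite_measure \<mu> by (rule sigma_finite_power_measure)
    show "(\<lambda>x. ennreal (u x powr p) * (\<integral>\<^sup>+y. ennreal (u (c *\<^sub>R y) powr p) * ?k x y \<partial>\<mu>)) \<in> borel_measurable \<mu>"
      by measurable
  qed
  also have "(\<integral>\<^sup>+x. ennreal (u x powr p) * (\<integral>\<^sup>+y. ennreal (u (c *\<^sub>R y) powr p) * ?k x y \<partial>\<mu>) \<partial>\<mu>)
      = (\<integral>\<^sup>+x. ennreal (u (c *\<^sub>R x) powr p) * (\<integral>\<^sup>+y. ennreal (u y powr p) * ?k x y \<partial>\<mu>) \<partial>\<mu>)"
    by (rule nn_integral_symmetric_kernel[OF sigma_finite_power_measure])
      (measurable, simp add: norm_minus_commute)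
  also have "\<dots> = (\<integral>\<^sup>+x. ennreal (u (c *\<^sub>R x) powr p * u x) \<partial>\<mu>)"
    using nonneg by (simp add: equation ennreal_mult)
  also have "\<dots> = ennreal (\<integral>x. u (c *\<^sub>R x) powr p * u x \<partial>\<mu>)"
    using integrable_mixed(2)[OF assms] nonneg by (intro nn_integral_eq_integral) auto
  finally show ?thesis
    using nonneg by (simp add: ennreal_mult[symmetric] ennreal_inj)
qed


section \<open>The defect is of higher order than the dilation\<close>

text \<open>The product measures how far \<open>u\<close> is from its dilate. It is nonnegative and of second order in
  \<open>c - 1\<close> wherever \<open>u\<close> is smooth, and its integral is a combination of the energies of \<open>u\<close> and of the dilate and of
  the two mixed energies.\<close>

definition defect :: "real \<Rightarrow> 'a \<Rightarrow> real" where
  "defect c x = (u x powr p - u (c *\<^sub>R x) powr p) * (u x - u (c *\<^sub>R x))"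

lemma energy_scaleR:
  assumes "1 \<le> c"
  shows "has_bochner_integral \<mu> (\<lambda>x. u (c *\<^sub>R x) powr (p + 1)) (c powr - N * energy)"
  using has_bochner_integral_scaleR[OF integrable_energy] assms by (simp add: energy_def)

lemma powr_Suc: "u x powr (p + 1) = u x powr p * u x"
  using pos[of x] by (simp add: powr_add)

lemma defect_expand:
  "defect c x = u x powr (p + 1) + u (c *\<^sub>R x) powr (p + 1)
    - u x powr p * u (c *\<^sub>R x) - u (c *\<^sub>R x) powr p * u x"
  unfolding defect_def powr_Suc by (simp add: algebra_simps)

lemma integrable_defect: "1 \<le> c \<Longrightarrow> integrable \<mu> (defect c)"
  unfolding defect_expand[abs_def]
  using integrable_energy integrable_mixed[of c] energy_scaleR[of c]
  by (auto simp: has_bochner_integral_iff)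

lemma defect_le:
  assumes "1 \<le> c"
  shows "defect c x \<le> u x powr (p + 1) - u (c *\<^sub>R x) powr (p + 1)"
proof -
  have "u (c *\<^sub>R x) powr p * u (c *\<^sub>R x) \<le> u (c *\<^sub>R x) powr p * u x"
    using scaleR_le[OF assms, of x] by (intro mult_left_mono) auto
  moreover have "u (c *\<^sub>R x) powr p * u (c *\<^sub>R x) \<le> u x powr p * u (c *\<^sub>R x)"
    using powr_scaleR_le[OF assms, of p x] pos[of "c *\<^sub>R x"] p_pos by (intro mult_right_mono) auto
  ultimately show ?thesis unfolding defect_expand powr_Suc by linarith
qed

text \<open>This improves \<open>defect_le\<close> by the factor \<open>\<epsilon>\<close> at the points where the dilate is relatively close to \<open>u\<close>.\<close>

lemma defect_le_small:
  assumes "1 \<le> c" and close: "u x powr p - u (c *\<^sub>R x) powr p \<le> \<epsilon> * u x powr p" and "0 \<le> \<epsilon>"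
  shows "defect c x \<le> \<epsilon> * (u x powr (p + 1) - u (c *\<^sub>R x) powr (p + 1))"
proof -
  have "defect c x \<le> (\<epsilon> * u x powr p) * (u x - u (c *\<^sub>R x))"
    unfolding defect_def using close scaleR_le[OF assms(1), of x] by (intro mult_right_mono) auto
  also have "\<dots> = \<epsilon> * (u x powr p * u x - u x powr p * u (c *\<^sub>R x))"
    by (simp add: algebra_simps)
  also have "\<dots> \<le> \<epsilon> * (u x powr p * u x - u (c *\<^sub>R x) powr p * u (c *\<^sub>R x))"
    using powr_scaleR_le[OF assms(1), of p x] pos[of "c *\<^sub>R x"] p_pos \<open>0 \<le> \<epsilon>\<close>
    by (intro mult_left_mono diff_left_mono mult_right_mono) auto
  finally show ?thesis by (simp add: powr_Suc)
qed

definition tail :: "real \<Rightarrow> real" where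
  "tail R = (\<integral>x. u x powr (p + 1) * indicator (- cball 0 R) x \<partial>\<mu>)"

lemma integrable_tail: "integrable \<mu> (\<lambda>x. u x powr (p + 1) * indicator (- cball 0 R) x)"
  using integrable_mult_indicator[OF _ integrable_energy, of "- cball 0 R"] by (simp add: mult.commute)

lemma tail_tendsto_0: "(\<lambda>k. tail (real k)) \<longlonglongrightarrow> 0"
proof -
  have [measurable]: "- cball (0::'a) R \<in> sets borel" for R by simp
  have "(\<lambda>k. \<integral>x. u x powr (p + 1) * indicator (- cball 0 (real k)) x \<partial>\<mu>) \<longlonglongrightarrow> integral\<^sup>L \<mu> (\<lambda>_::'a. 0)"
  proof (rule integral_dominated_convergence[OF _ _ integrable_energy])
    show "AE x in \<mu>. (\<lambda>k. u x powr (p + 1) * indicator (- cball 0 (real k)) x) \<longlonglongrightarrow> 0"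
    proof (rule AE_I2)
      fix x :: 'a
      have "eventually (\<lambda>k. norm x \<le> real k) sequentially"
        using filterlim_real_sequentially by (rule filterlim_at_top[THEN iffD1, rule_format])
      then have "eventually (\<lambda>k. u x powr (p + 1) * indicator (- cball 0 (real k)) x = 0) sequentially"
        by eventually_elim simp
      then show "(\<lambda>k. u x powr (p + 1) * indicator (- cball 0 (real k)) x) \<longlonglongrightarrow> 0"
        by (rule tendsto_eventually)
    qed
  qed (auto simp: indicator_def)
  then show ?thesis by (simp add: tail_def)
qed

text \<open>By scaling, the dilated term integrates to \<open>c powr - N * tail (c * R)\<close>. Hence the integral differs from
  \<open>(1 - c powr - N) * tail R\<close> only by the contribution of the shell between the radii \<open>R\<close> and \<open>c R\<close>, whose
  mass is proportional to \<open>c powr N - 1\<close>. So the whole integral carries the factor \<open>1 - c powr - N\<close>.\<close>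

lemma tail_defect_le:
  assumes c: "1 \<le> c" and R: "0 < R" and A: "\<And>x. R < norm x \<Longrightarrow> u x powr (p + 1) \<le> A"
  shows "(\<integral>x. (u x powr (p + 1) - u (c *\<^sub>R x) powr (p + 1)) * indicator (- cball 0 R) x \<partial>\<mu>)
    \<le> (1 - c powr - N) * (tail R + A * R powr N * unit_mass)"
proof -
  let ?f = "\<lambda>R x. u x powr (p + 1) * indicator (- cball 0 R) x"
  let ?S = "cball 0 (c * R) - cball (0::'a) R"
  have c0: "0 < c" and cR: "0 < c * R" using c R by auto
  have scaled: "has_bochner_integral \<mu> (\<lambda>x. u (c *\<^sub>R x) powr (p + 1) * indicator (- cball 0 R) x)
      (c powr - N * tail (c * R))"
  proof -
    have "indicator (- cball 0 (c * R)) (c *\<^sub>R x) = (indicator (- cball 0 R) x :: real)" for x :: 'a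
      using c0 by (simp add: indicator_def)
    then show ?thesis
      using has_bochner_integral_scaleR[OF integrable_tail _ c0, of "c * R"] by (simp add: tail_def)
  qed
  have S: "emeasure \<mu> ?S = ennreal (c powr N * (R powr N * unit_mass) - R powr N * unit_mass)"
  proof -
    have "emeasure \<mu> ?S = emeasure \<mu> (cball 0 (c * R)) - emeasure \<mu> (cball 0 R)"
      using c R by (intro emeasure_Diff) (auto simp: emeasure_cball subset_iff intro: order_trans[OF _ mult_right_mono[of 1 c R, simplified]])
    also have "\<dots> = ennreal (c powr N * (R powr N * unit_mass) - R powr N * unit_mass)"
      using c0 R cR unit_mass_pos by (simp add: emeasure_cball ennreal_minus powr_mult mult.assoc)
    finally show ?thesis .
  qed
  have A0: "0 \<le> A"
  proof -
    obtain e :: 'a where "norm e = 1" using nonempty_Basis norm_Basis by blast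
    then show ?thesis using A[of "(R + 1) *\<^sub>R e"] R powr_ge_zero[of "u ((R + 1) *\<^sub>R e)"] by (simp, meson order_trans)
  qed
  have "c powr N \<ge> 1" using c N_pos by (simp add: ge_one_powr_ge_zero)
  then have "1 * (R powr N * unit_mass) \<le> c powr N * (R powr N * unit_mass)"
    using unit_mass_pos by (intro mult_right_mono) auto
  then have mS: "measure \<mu> ?S = (c powr N - 1) * (R powr N * unit_mass)"
    using S by (simp add: measure_def left_diff_distrib)
  have "tail R - tail (c * R) = (\<integral>x. ?f R x - ?f (c * R) x \<partial>\<mu>)"
    unfolding tail_def by (intro Bochner_Integration.integral_diff[symmetric] integrable_tail)
  also have "\<dots> \<le> (\<integral>x. A * indicator ?S x \<partial>\<mu>)"
  proof (rule integral_mono)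
    show "integrable \<mu> (\<lambda>x. A * indicator ?S x)"
      using S by (intro integrable_mult_right integrable_real_indicator) auto
    fix x
    show "?f R x - ?f (c * R) x \<le> A * indicator ?S x"
      using A[of x] A0 mult_right_mono[of 1 c R] c R by (auto simp: indicator_def)
  qed (intro Bochner_Integration.integrable_diff integrable_tail)
  also have "\<dots> = A * ((c powr N - 1) * (R powr N * unit_mass))"
    by (simp add: mS)
  finally have diff: "tail R - tail (c * R) \<le> A * ((c powr N - 1) * (R powr N * unit_mass))" .
  have "(\<integral>x. (u x powr (p + 1) - u (c *\<^sub>R x) powr (p + 1)) * indicator (- cball 0 R) x \<partial>\<mu>)
      = tail R - c powr - N * tail (c * R)"
    using integrable_tail[of R] scaled
    by (simp add: left_diff_distrib has_bochner_integral_iff tail_def)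
  also have "\<dots> = (1 - c powr - N) * tail R + c powr - N * (tail R - tail (c * R))"
    by (simp add: algebra_simps)
  also have "\<dots> \<le> (1 - c powr - N) * tail R + c powr - N * (A * ((c powr N - 1) * (R powr N * unit_mass)))"
    using diff by (intro add_left_mono mult_left_mono) auto
  also have "c powr - N * (A * ((c powr N - 1) * (R powr N * unit_mass)))
      = (1 - c powr - N) * (A * R powr N * unit_mass)"
    using c0 by (simp add: powr_minus_divide field_simps)
  finally show ?thesis by (simp add: algebra_simps)
qed

text \<open>On a ball \<open>u\<^sup>p\<close> is uniformly continuous and bounded below by a positive constant, so an absolute error bound
  is also a relative one.\<close>

lemma eventually_uniformly_close:
  assumes R: "0 < R" and \<epsilon>: "0 < \<epsilon>"
  shows "\<forall>\<^sub>F c in at_right 1. \<forall>x\<in>cball 0 R. u x powr p - u (c *\<^sub>R x) powr p \<le> \<epsilon> * u x powr p"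
proof -
  obtain e :: 'a where e: "norm e = 1" using nonempty_Basis norm_Basis by blast
  define m where "m = u (R *\<^sub>R e) powr p"
  have m: "0 < m" using pos[of "R *\<^sub>R e"] by (simp add: m_def)
  have lower: "m \<le> u x powr p" if "x \<in> cball 0 R" for x
    unfolding m_def using that e R p_pos pos[of "R *\<^sub>R e"] decreasing[of x "R *\<^sub>R e"]
    by (intro powr_mono2) auto
  have "continuous_on (cball 0 (2 * R)) (\<lambda>x. u x powr p)"
    using continuous_on_subset[OF continuous] pos
    by (intro continuous_intros) (auto simp: less_imp_neq[symmetric])
  then have "uniformly_continuous_on (cball 0 (2 * R)) (\<lambda>x. u x powr p)"
    by (intro compact_uniformly_continuous) auto
  then obtain d where d: "0 < d" and
    close: "\<And>x y. x \<in> cball 0 (2 * R) \<Longrightarrow> y \<in> cball 0 (2 * R) \<Longrightarrow> dist y x < d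
      \<Longrightarrow> dist (u y powr p) (u x powr p) < \<epsilon> * m"
    unfolding uniformly_continuous_on_def using mult_pos_pos[OF \<epsilon> m] by blast
  have "\<forall>\<^sub>F c in at_right (1::real). c \<in> {1<..<min 2 (1 + d / R)}"
    using d R by (intro eventually_at_rightI[of 1 "min 2 (1 + d / R)"]) auto
  then show ?thesis
  proof (eventually_elim, intro ballI)
    fix c :: real and x :: 'a
    assume c: "c \<in> {1<..<min 2 (1 + d / R)}" and x: "x \<in> cball 0 R"
    have "norm (c *\<^sub>R x) \<le> 2 * R" 
      using c x by (auto intro!: mult_mono)
    moreover have "dist (c *\<^sub>R x) x < d"
    proof -
      have "dist (c *\<^sub>R x) x = norm ((c - 1) *\<^sub>R x)"
        by (simp add: dist_norm scaleR_diff_left)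
      also have "\<dots> \<le> (c - 1) * R"
        using c x by (auto intro!: mult_left_mono)
      also have "\<dots> < d" using c R by (simp add: field_simps)
      finally show ?thesis .
    qed
    ultimately have "dist (u (c *\<^sub>R x) powr p) (u x powr p) < \<epsilon> * m"
      using x R by (intro close) auto
    then have "u x powr p - u (c *\<^sub>R x) powr p \<le> \<epsilon> * m"
      by (simp add: dist_real_def)
    also have "\<dots> \<le> \<epsilon> * u x powr p"
      using lower[OF x] \<epsilon> by simp
    finally show "u x powr p - u (c *\<^sub>R x) powr p \<le> \<epsilon> * u x powr p" .
  qed
qed

text \<open>The shell term is bounded by \<open>A R\<^sup>N\<close>, where \<open>A\<close> bounds \<open>u\<^bsup>p+1\<^esup>\<close> outside the ball; the decay estimate makes
  this small for large \<open>R\<close>.\<close>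

lemma small_tail:
  assumes "0 < \<eta>"
  obtains R A where "0 < R" "\<And>x. R < norm x \<Longrightarrow> u x powr (p + 1) \<le> A"
    "tail R + A * R powr N * unit_mass < \<eta>"
proof -
  obtain C \<kappa> where C: "0 < C" "0 < \<kappa>"
    and dec: "\<And>x. x \<noteq> 0 \<Longrightarrow> u x powr (p + 1) \<le> C * norm x powr - (N + \<kappa>)"
    using decay by blast
  have "(\<lambda>k. tail (real k) + C * real k powr - \<kappa> * unit_mass) \<longlonglongrightarrow> 0 + C * 0 * unit_mass"
    using C by (intro tendsto_intros tail_tendsto_0 tendsto_neg_powr filterlim_real_sequentially) auto
  then have "eventually (\<lambda>k. tail (real k) + C * real k powr - \<kappa> * unit_mass < \<eta>) sequentially"
    using assms by (intro order_tendstoD) auto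
  with eventually_gt_at_top[of 0]
  have "eventually (\<lambda>k. 0 < k \<and> tail (real k) + C * real k powr - \<kappa> * unit_mass < \<eta>) sequentially"
    by (rule eventually_conj)
  from eventually_happens'[OF sequentially_bot this]
  obtain k where k: "0 < k" "tail (real k) + C * real k powr - \<kappa> * unit_mass < \<eta>" by blast
  define R where "R = real k"
  have R: "0 < R" using k by (simp add: R_def)
  have "u x powr (p + 1) \<le> C * R powr - (N + \<kappa>)" if "R < norm x" for x
  proof -
    have "u x powr (p + 1) \<le> C * norm x powr - (N + \<kappa>)"
      using that R by (intro dec) auto
    also have "\<dots> \<le> C * R powr - (N + \<kappa>)"
      using that R C N_pos by (intro mult_left_mono powr_mono2') auto
    finally show ?thesis .
  qed
  moreover have "C * R powr - (N + \<kappa>) * R powr N = C * R powr - \<kappa>"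
    by (simp add: mult.assoc powr_add[symmetric])
  ultimately show ?thesis
    using R k(2) by (intro that[of R "C * R powr - (N + \<kappa>)"]) (simp_all only: R_def)
qed

text \<open>Inside a large ball the defect is a small multiple of \<open>u\<^bsup>p+1\<^esup> - v\<^bsup>p+1\<^esup>\<close> by uniform continuity, and the
  exterior contributes little by \<open>tail_defect_le\<close>. The bound is relative to \<open>1 - c powr - N\<close>, which is
  asymptotic to \<open>N (c - 1)\<close>; so the integral is \<open>o(c - 1)\<close>.\<close>

lemma eventually_defect_le:
  assumes "0 < \<eta>"
  shows "\<forall>\<^sub>F c in at_right 1. (\<integral>x. defect c x \<partial>\<mu>) \<le> \<eta> * (1 - c powr - N)"
proof -
  obtain R A where R: "0 < R" and A: "\<And>x. R < norm x \<Longrightarrow> u x powr (p + 1) \<le> A"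
    and small: "tail R + A * R powr N * unit_mass < \<eta> / 2"
    using small_tail[of "\<eta> / 2"] assms by auto
  define \<epsilon> where "\<epsilon> = \<eta> / (2 * energy)"
  have \<epsilon>: "0 < \<epsilon>" using assms energy_pos by (simp add: \<epsilon>_def)
  have "\<forall>\<^sub>F c in at_right (1::real). 1 < c" by (rule eventually_at_right_less)
  with eventually_uniformly_close[OF R \<epsilon>] show ?thesis
  proof eventually_elim
    case (elim c)
    then have c: "1 \<le> c" by simp
    let ?g = "\<lambda>x. u x powr (p + 1) - u (c *\<^sub>R x) powr (p + 1)"
    have g: "has_bochner_integral \<mu> ?g (energy - c powr - N * energy)"
      using energy_scaleR[OF c] integrable_energy
      by (intro has_bochner_integral_diff) (auto simp: has_bochner_integral_iff energy_def)
    then have ig: "integrable \<mu> ?g" by (simp add: has_bochner_integral_iff)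
    have igR: "integrable \<mu> (\<lambda>x. ?g x * indicator (- cball 0 R) x)"
      using integrable_mult_indicator[OF _ ig, of "- cball 0 R"] by (simp add: mult.commute)
    have "(\<integral>x. defect c x \<partial>\<mu>) \<le> (\<integral>x. \<epsilon> * ?g x + ?g x * indicator (- cball 0 R) x \<partial>\<mu>)"
    proof (rule integral_mono)
      fix x
      have g0: "0 \<le> ?g x" using powr_scaleR_le[OF c, of "p + 1" x] p_pos by simp
      show "defect c x \<le> \<epsilon> * ?g x + ?g x * indicator (- cball 0 R) x"
      proof (cases "x \<in> cball 0 R")
        case True
        then show ?thesis using defect_le_small[OF c, of x \<epsilon>] elim \<epsilon> by simp
      next
        case False
        have "0 \<le> \<epsilon> * ?g x" using \<epsilon> g0 by (intro mult_nonneg_nonneg) auto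
        then show ?thesis using defect_le[OF c, of x] False by simp
      qed
    qed (use ig igR integrable_defect[OF c] in auto)
    also have "\<dots> = \<epsilon> * (energy - c powr - N * energy) + (\<integral>x. ?g x * indicator (- cball 0 R) x \<partial>\<mu>)"
      using g ig igR by (simp add: has_bochner_integral_iff)
    also have "\<dots> \<le> \<epsilon> * (energy - c powr - N * energy)
        + (1 - c powr - N) * (tail R + A * R powr N * unit_mass)"
      using tail_defect_le[OF c R A] by simp
    also have "\<epsilon> * (energy - c powr - N * energy) = (1 - c powr - N) * (\<eta> / 2)"
      using energy_pos by (simp add: \<epsilon>_def field_simps)
    also have "(1 - c powr - N) * (\<eta> / 2) + (1 - c powr - N) * (tail R + A * R powr N * unit_mass)
        \<le> (1 - c powr - N) * (\<eta> / 2) + (1 - c powr - N) * (\<eta> / 2)"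
    proof (intro add_left_mono mult_left_mono)
      have "c powr - N \<le> 1 powr - N"
        using c N_pos by (intro powr_mono2') auto
      then show "0 \<le> 1 - c powr - N" by simp
    qed (use small in simp)
    finally show ?case by (simp add: algebra_simps)
  qed
qed

section \<open>The Pohozaev lower bound and the contradiction\<close>

text \<open>Young's inequality with the weights \<open>p / (p + 1)\<close> and \<open>1 / (p + 1)\<close>.\<close>

lemma mixed_energy_le:
  assumes c: "1 \<le> c"
  shows "(\<integral>x. u x powr p * u (c *\<^sub>R x) \<partial>\<mu>) \<le> (p + c powr - N) / (p + 1) * energy"
proof -
  have young: "u x powr p * u (c *\<^sub>R x)
      \<le> p / (p + 1) * u x powr (p + 1) + 1 / (p + 1) * u (c *\<^sub>R x) powr (p + 1)" for x
  proof -
    have "u x powr p * u (c *\<^sub>R x) = (u x powr (p + 1)) powr (p / (p + 1)) * (u (c *\<^sub>R x) powr (p + 1)) powr (1 / (p + 1))"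
      using p_pos pos[of "c *\<^sub>R x"] by (simp add: powr_powr)
    also have "\<dots> \<le> p / (p + 1) * u x powr (p + 1) + 1 / (p + 1) * u (c *\<^sub>R x) powr (p + 1)"
      using p_pos by (intro Youngs_inequality_0) (auto simp: add_divide_distrib[symmetric] pos less_imp_neq[OF pos, symmetric])
    finally show ?thesis .
  qed
  have "(\<integral>x. u x powr p * u (c *\<^sub>R x) \<partial>\<mu>)
      \<le> (\<integral>x. p / (p + 1) * u x powr (p + 1) + 1 / (p + 1) * u (c *\<^sub>R x) powr (p + 1) \<partial>\<mu>)"
    using integrable_mixed[OF c] integrable_energy energy_scaleR[OF c] young
    by (intro integral_mono) (auto simp: has_bochner_integral_iff)
  also have "\<dots> = p / (p + 1) * energy + 1 / (p + 1) * (c powr - N * energy)"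
    using integrable_energy energy_scaleR[OF c] 
    by (simp add: has_bochner_integral_iff energy_def)
  also have "\<dots> = (p + c powr - N) / (p + 1) * energy"
    by (simp add: add_divide_distrib distrib_right)
  finally show ?thesis .
qed

text \<open>Reciprocity expresses both mixed energies through one of them, and Young's inequality bounds that
  one from above. At \<open>c = 1\<close> the left-hand side vanishes, and its derivative is the energy times
  \<open>2 N - (p + 1) (n - \<alpha>)\<close>.\<close>

lemma integral_defect_ge:
  assumes c: "1 \<le> c"
  shows "energy * (1 + p * c powr - N - c powr - (\<alpha> - \<sigma>) * (p + c powr - N))
    \<le> (p + 1) * (\<integral>x. defect c x \<partial>\<mu>)"
proof -
  define F where "F = (\<integral>x. u x powr p * u (c *\<^sub>R x) \<partial>\<mu>)"
  define \<tau> where "\<tau> = c powr - (\<alpha> - \<sigma>)"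
  have "\<tau> * c powr (\<alpha> - \<sigma>) = 1"
    using c by (simp add: \<tau>_def powr_add[symmetric])
  then have G: "(\<integral>x. u (c *\<^sub>R x) powr p * u x \<partial>\<mu>) = \<tau> * F"
    using mixed_energy_reciprocity[OF c] by (simp add: F_def mult.assoc[symmetric])
  have D: "(\<integral>x. defect c x \<partial>\<mu>) = energy + c powr - N * energy - F - \<tau> * F"
    using integrable_energy integrable_mixed[OF c] energy_scaleR[OF c] G
    by (simp add: defect_expand has_bochner_integral_iff energy_def F_def)
  have "(p + 1) * F \<le> (p + c powr - N) * energy"
    using mixed_energy_le[OF c] p_pos by (simp add: F_def field_simps)
  then have "(1 + \<tau>) * ((p + 1) * F) \<le> (1 + \<tau>) * ((p + c powr - N) * energy)"
    by (intro mult_left_mono) (auto simp: \<tau>_def)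
  then show ?thesis unfolding D \<tau>_def[symmetric] by (simp add: algebra_simps)
qed

text \<open>The lower bound for the integral of the defect has a positive slope at \<open>c = 1\<close>, the upper bound
  an arbitrarily small slope. So the difference \<open>\<psi>\<close> of the two bounds is at once positive and
  nonpositive just to the right of 1.\<close>

lemma no_subcritical_radial_solution: False
proof -
  define \<theta> where "\<theta> = 2 * N - (p + 1) * (real DIM('a) - \<alpha>)"
  have \<theta>: "0 < \<theta>" using subcritical by (simp add: \<theta>_def N_def)
  \<comment> \<open>chosen so that the upper bound takes away half of the slope \<open>energy * \<theta>\<close>\<close>
  define \<eta> where "\<eta> = energy * \<theta> / (2 * N * (p + 1))"
  have \<eta>: "0 < \<eta>" using energy_pos \<theta> N_pos p_pos by (simp add: \<eta>_def)
  define \<psi> where "\<psi> c = energy * (1 + p * c powr - N - c powr - (\<alpha> - \<sigma>) * (p + c powr - N))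
      - (p + 1) * \<eta> * (1 - c powr - N)" for c :: real
  have "(\<psi> has_real_derivative energy * (- p * N + (\<alpha> - \<sigma>) * (p + 1) + N) - (p + 1) * \<eta> * N) (at 1)"
    unfolding \<psi>_def by (auto intro!: derivative_eq_intros simp: algebra_simps)
  also have "energy * (- p * N + (\<alpha> - \<sigma>) * (p + 1) + N) = energy * \<theta>"
    by (simp add: \<theta>_def N_def algebra_simps)
  also have "(p + 1) * \<eta> * N = energy * \<theta> / 2"
  proof -
    have "\<eta> * (2 * N * (p + 1)) = energy * \<theta>"
      using N_pos p_pos by (simp add: \<eta>_def)
    then show ?thesis by (simp add: mult_ac)
  qed
  finally have "(\<psi> has_real_derivative energy * \<theta> / 2) (at 1)" by (simp add: mult.commute)
  from DERIV_pos_inc_right[OF this] energy_pos \<theta>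
  obtain d where d: "0 < d" and inc: "\<And>h. 0 < h \<Longrightarrow> h < d \<Longrightarrow> \<psi> 1 < \<psi> (1 + h)" by auto
  have "\<forall>\<^sub>F c in at_right (1::real). c \<in> {1<..<1 + d}"
    using d by (intro eventually_at_rightI[of 1 "1 + d"]) auto
  with eventually_defect_le[OF \<eta>] have "\<forall>\<^sub>F c in at_right (1::real). False"
  proof eventually_elim
    case (elim c)
    then have "(p + 1) * (\<integral>x. defect c x \<partial>\<mu>) \<le> (p + 1) * (\<eta> * (1 - c powr - N))"
      using p_pos by (intro mult_left_mono) auto
    with integral_defect_ge[of c] elim have "\<psi> c \<le> 0"
      by (simp add: \<psi>_def mult.assoc)
    moreover have "\<psi> 1 < \<psi> c" using inc[of "c - 1"] elim by simp
    moreover have "\<psi> 1 = 0" by (simp add: \<psi>_def)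
    ultimately show ?case by simp
  qed
  then show False by (simp add: trivial_limit_at_right_real)
qed

end

section \<open>Nonexistence of positive radial solutions\<close>

theorem theorem4:
  fixes \<alpha> \<sigma> p :: real
  assumes "CARD('n::finite) \<ge> 3"
    and "2 \<le> \<alpha>" and "\<alpha> < real CARD('n)"
    and "\<sigma> < \<alpha>"
    and "0 < p" and "p < (real CARD('n) + \<alpha> - 2 * \<sigma>) / (real CARD('n) - \<alpha>)"
  shows "\<not> (\<exists>u :: real ^ 'n \<Rightarrow> real. positive_radial_solution \<alpha> \<sigma> p u)"
proof
  assume "\<exists>u :: real ^ 'n \<Rightarrow> real. positive_radial_solution \<alpha> \<sigma> p u"
  then obtain u :: "real ^ 'n \<Rightarrow> real" where u: "positive_radial_solution \<alpha> \<sigma> p u" ..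
  then have pos: "0 < u x" and dec: "norm x \<le> norm y \<Longrightarrow> u y \<le> u x" and cont: "continuous_on UNIV u"
    and eq: "has_bochner_integral lborel
        (\<lambda>y. u y powr p / (norm (x - y) powr (real CARD('n) - \<alpha>) * norm y powr \<sigma>)) (u x)" for x y
    unfolding positive_radial_solution_def radially_decreasing_def solves_integral_equation_def by blast+
  have [measurable]: "u \<in> borel_measurable borel"
    using cont by (rule borel_measurable_continuous_onI)
  interpret subcritical_radial_solution u \<alpha> \<sigma> p
  proof
    fix x :: "real ^ 'n"
    let ?g = "\<lambda>y. u y powr p / (norm (x - y) powr (real CARD('n) - \<alpha>) * norm y powr \<sigma>)"
    have g: "?g y = norm y powr - \<sigma> * (u y powr p * norm (x - y) powr (\<alpha> - real DIM(real ^ 'n)))" for y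
    proof -
      have "norm (x - y) powr (\<alpha> - real DIM(real ^ 'n)) = 1 / norm (x - y) powr (real CARD('n) - \<alpha>)"
        by (simp add: powr_minus_divide[symmetric])
      then show ?thesis by (simp add: powr_minus_divide)
    qed
    have "(\<integral>\<^sup>+y. ennreal (u y powr p) * ennreal (norm (x - y) powr (\<alpha> - real DIM(real ^ 'n))) \<partial>power_measure \<sigma>)
        = (\<integral>\<^sup>+y. ennreal (?g y) \<partial>lborel)"
      unfolding g by (subst nn_integral_power_measure) (auto simp: ennreal_mult)
    also have "\<dots> = ennreal (u x)"
      using eq[of x] by (subst nn_integral_eq_integral) (auto simp: has_bochner_integral_iff)
    finally show "(\<integral>\<^sup>+y. ennreal (u y powr p) * ennreal (norm (x - y) powr (\<alpha> - real DIM(real ^ 'n))) \<partial>power_measure \<sigma>)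
        = ennreal (u x)" .
  next
    have "p * (real CARD('n) - \<alpha>) < real CARD('n) + \<alpha> - 2 * \<sigma>"
      using assms by (simp add: pos_less_divide_eq)
    then show "(p + 1) * (real DIM(real ^ 'n) - \<alpha>) < 2 * (real DIM(real ^ 'n) - \<sigma>)"
      by (simp add: algebra_simps)
  qed (use assms pos dec cont in auto)
  show False by (rule no_subcritical_radial_solution)
qed

end
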